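(* Let $\mathcal{H}$ be a complex Hilbert space and let $T\in L(\mathcal{H})$. The following assertions are equivalent: (1) $T\in\mathfrak{X}$, i.e. there exist orthogonal projections $P,Q\in L(\mathcal{H})$ with $T=PQ$; (2) $T^2=TT^*T$; (3) $\|Tx\|^2=\langle Tx,x\rangle$ for all $x\in N(T)^\perp$. In this case, $T=P_{\overline{R(T)}}P_{N(T)^\perp}=P_{\overline{R(T)}}P_{\overline{R(T^* )}}=P_{N(T^* )^\perp}P_{N(T)^\perp}$.
   Context: $L(\mathcal{H})$ is the algebra of bounded linear operators on $\mathcal{H}$; $R(T)$ and $N(T)$ denote the range and nullspace of $T$. An orthogonal projection is an operator $P\in L(\mathcal{H})$ with $P^2=P=P^*$. For a closed subspace $\mathcal{M}$, $P_{\mathcal{M}}$ is the orthogonal projection onto $\mathcal{M}$. $\mathfrak{X}=\{PQ: P,Q \text{ orthogonal projections in } L(\mathcal{H})\}$. *)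

theory Defs
  imports "HOL-Analysis.Analysis"
begin

(* A complex inner product space. The inner product of the real inner product space underlying it
   is Re (cinner x y), so the inherited norm satisfies norm x = sqrt (Re (cinner x x)), and the
   positive definiteness of cinner is that of inner. cinner is linear in its first argument. *)

class complex_inner = real_inner +
  fixes scaleC :: "complex \<Rightarrow> 'a \<Rightarrow> 'a" (infixr "*\<^sub>C" 75)
    and cinner :: "'a \<Rightarrow> 'a \<Rightarrow> complex"
  assumes scaleC_add_right: "c *\<^sub>C (x + y) = c *\<^sub>C x + c *\<^sub>C y"
    and scaleC_add_left: "(c + d) *\<^sub>C x = c *\<^sub>C x + d *\<^sub>C x"
    and scaleC_scaleC: "c *\<^sub>C (d *\<^sub>C x) = (c * d) *\<^sub>C x"
    and scaleC_of_real: "complex_of_real r *\<^sub>C x = r *\<^sub>R x"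
    and cinner_add_left: "cinner (x + y) z = cinner x z + cinner y z"
    and cinner_scaleC_left: "cinner (c *\<^sub>C x) y = c * cinner x y"
    and cinner_commute: "cinner x y = cnj (cinner y x)"
    and inner_eq_Re_cinner: "inner x y = Re (cinner x y)"

class chilbert_space = complex_inner + complete_space

lemma scaleC_one: "1 *\<^sub>C x = (x :: 'a::complex_inner)"
  using scaleC_of_real[of 1 x] by simp

lemma cinner_self: "cinner x x = complex_of_real ((norm (x :: 'a::complex_inner))\<^sup>2)"
proof (rule complex_eqI)
  show "Re (cinner x x) = Re (complex_of_real ((norm x)\<^sup>2))"
    by (simp add: power2_norm_eq_inner inner_eq_Re_cinner)
  have "Im (cinner x x) = - Im (cinner x x)"
    by (metis cinner_commute cnj.sel(2))
  then show "Im (cinner x x) = Im (complex_of_real ((norm x)\<^sup>2))"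
    by simp
qed

lemma cinner_self_eq_0_iff: "cinner x x = 0 \<longleftrightarrow> x = (0 :: 'a::complex_inner)"
  by (simp add: cinner_self)

instantiation complex :: chilbert_space
begin

definition scaleC_complex :: "complex \<Rightarrow> complex \<Rightarrow> complex" where
  "scaleC_complex c x = c * x"

definition cinner_complex :: "complex \<Rightarrow> complex \<Rightarrow> complex" where
  "cinner_complex x y = x * cnj y"

instance
  by standard
    (auto simp: scaleC_complex_def cinner_complex_def algebra_simps scaleR_conv_of_real
      inner_complex_def)

end

definition bounded_clinear :: "('a::complex_inner \<Rightarrow> 'b::complex_inner) \<Rightarrow> bool" where
  "bounded_clinear T \<longleftrightarrow> bounded_linear T \<and> (\<forall>c x. T (c *\<^sub>C x) = c *\<^sub>C T x)"

definition nullspace :: "('a::complex_inner \<Rightarrow> 'b::complex_inner) \<Rightarrow> 'a set" where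
  "nullspace T = {x. T x = 0}"

definition ortho_compl :: "'a::complex_inner set \<Rightarrow> 'a set" where
  "ortho_compl S = {x. \<forall>y\<in>S. cinner x y = 0}"

(* Only meaningful for bounded operators between Hilbert spaces, where the adjoint exists
   (by the Riesz representation theorem) and is unique. *)

definition cadjoint :: "('a::chilbert_space \<Rightarrow> 'b::chilbert_space) \<Rightarrow> 'b \<Rightarrow> 'a" where
  "cadjoint T = (THE S. \<forall>x y. cinner (T x) y = cinner x (S y))"

definition orth_projection :: "('a::chilbert_space \<Rightarrow> 'a) \<Rightarrow> bool" where
  "orth_projection P \<longleftrightarrow> bounded_clinear P \<and> P \<circ> P = P \<and> cadjoint P = P"

(* Only meaningful for closed complex subspaces M, for which exactly one such P exists. *)

definition orth_proj_onto :: "'a::chilbert_space set \<Rightarrow> 'a \<Rightarrow> 'a" where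
  "orth_proj_onto M = (THE P. orth_projection P \<and> range P = M)"

definition proj_products :: "('a::chilbert_space \<Rightarrow> 'a) set" where
  "proj_products = {P \<circ> Q | P Q. orth_projection P \<and> orth_projection Q}"

end

(* The equation T^2 = T T* T says that T x - T* T x lies in N(T) for every x, that is,
   <T x, z> = <T x, T z> for all x and all z in N(T)^\<bottom>. Restricting to x = z gives (3), and
   polarisation on N(T)^\<bottom> recovers the equation from (3). The same identity says that z - T z is
   orthogonal to R(T) for z in N(T)^\<bottom>, so T z is the projection of z onto the closure of R(T);
   since T vanishes on N(T), this is the canonical factorisation. *)

theory Submission
  imports Defs
begin

section \<open>Orthogonal decomposition and the Riesz representation\<close>

text \<open>Serves minimising sequences, where the parallelogram law bounds the squared distance of
  two members by the sum of their two errors.\<close>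

lemma cauchy_of_norm_square_bound:
  fixes y :: "nat \<Rightarrow> 'a::real_normed_vector"
  assumes "\<And>m n. (norm (y m - y n))\<^sup>2 \<le> c / real (Suc m) + c / real (Suc n)"
  shows "Cauchy y"
proof (rule metric_CauchyI)
  fix e :: real assume e: "0 < e"
  \<comment> \<open>The 2 gives each of the two error terms half of e^2; the absolute value allows
    \<open>c\<close> of either sign.\<close>
  obtain N where N: "2 * \<bar>c\<bar> / e\<^sup>2 < real N"
    using reals_Archimedean2 by blast
  have small: "c / real (Suc n) < e\<^sup>2 / 2" if "n \<ge> N" for n
  proof -
    have "2 * \<bar>c\<bar> < e\<^sup>2 * real N"
      using N e by (simp add: divide_simps mult.commute split: if_splits)
    also have "\<dots> \<le> e\<^sup>2 * real (Suc n)"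
      using that by (intro mult_left_mono) auto
    finally have "2 * c < e\<^sup>2 * real (Suc n)" by linarith
    then show ?thesis by (simp add: divide_simps del: of_nat_Suc)
  qed
  show "\<exists>N. \<forall>m\<ge>N. \<forall>n\<ge>N. dist (y m) (y n) < e"
  proof (intro exI allI impI)
    fix m n assume "m \<ge> N" "n \<ge> N"
    then have "(norm (y m - y n))\<^sup>2 < e\<^sup>2"
      using assms[of m n] small[of m] small[of n] by linarith
    then show "dist (y m) (y n) < e"
      using e by (simp add: dist_norm power2_less_imp_less)
  qed
qed

text \<open>A sequence in \<open>M\<close> whose squared distances to \<open>x\<close> tend to the
  infimum \<open>d\<close> is Cauchy: midpoints stay in \<open>M\<close>, hence at squared distance
  at least \<open>d\<close>, and the parallelogram law turns this into a bound on the gaps.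
  Completeness gives a limit, which closedness keeps in \<open>M\<close>.\<close>

lemma nearest_point_exists:
  fixes M :: "'a::{real_inner, complete_space} set"
  assumes M: "closed M" "subspace M"
  shows "\<exists>m\<in>M. \<forall>y\<in>M. norm (x - m) \<le> norm (x - y)"
proof -
  let ?A = "(\<lambda>y. (norm (x - y))\<^sup>2) ` M"
  define d where "d = Inf ?A"
  have ne: "?A \<noteq> {}" using subspace_0[OF M(2)] by blast
  have bdd: "bdd_below ?A" by (rule bdd_belowI[of _ 0]) auto
  have low: "d \<le> (norm (x - y))\<^sup>2" if "y \<in> M" for y
    unfolding d_def using that bdd by (simp add: cInf_lower)
  have "\<exists>y\<in>M. (norm (x - y))\<^sup>2 < d + 1 / real (Suc n)" for n
    using cInf_lessD[OF ne, of "d + 1 / real (Suc n)"] unfolding d_def by auto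
  then obtain y where y: "\<And>n. y n \<in> M" "\<And>n. (norm (x - y n))\<^sup>2 < d + 1 / real (Suc n)"
    by metis
  have "Cauchy y"
  proof (rule cauchy_of_norm_square_bound)
    fix m n
    have mid: "(1/2) *\<^sub>R (y m + y n) \<in> M"
      using M(2) y(1) by (simp add: subspace_add subspace_scale)
    \<comment> \<open>parallelogram law\<close>
    have "(norm (y m - y n))\<^sup>2 = 2 * (norm (x - y m))\<^sup>2 + 2 * (norm (x - y n))\<^sup>2
        - 4 * (norm (x - (1/2) *\<^sub>R (y m + y n)))\<^sup>2"
      by (simp add: power2_norm_eq_inner inner_diff_left inner_diff_right inner_add_left
          inner_add_right inner_commute algebra_simps)
    then show "(norm (y m - y n))\<^sup>2 \<le> 2 / real (Suc m) + 2 / real (Suc n)"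
      using low[OF mid] y(2)[of m] y(2)[of n] by linarith
  qed
  then obtain l where l: "y \<longlonglongrightarrow> l"
    using Cauchy_convergent convergent_def by blast
  have lM: "l \<in> M" using closed_sequentially[OF M(1) _ l] y(1) by blast
  have "(\<lambda>n. (norm (x - y n))\<^sup>2) \<longlonglongrightarrow> (norm (x - l))\<^sup>2"
    by (intro tendsto_intros l)
  moreover have "(\<lambda>n. d + 1 / real (Suc n)) \<longlonglongrightarrow> d + 0"
    using LIMSEQ_inverse_real_of_nat by (intro tendsto_intros) (simp add: inverse_eq_divide)
  ultimately have "(norm (x - l))\<^sup>2 \<le> d"
    using y(2) by (intro LIMSEQ_le[of _ _ "\<lambda>n. d + 1 / real (Suc n)"]) (auto intro: less_imp_le)
  then have "norm (x - l) \<le> norm (x - z)" if "z \<in> M" for z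
    using low[OF that] by (meson norm_ge_zero order_trans power2_le_imp_le)
  then show ?thesis using lM by blast
qed

text \<open>Take \<open>m\<close> nearest to \<open>x\<close>: a non-orthogonal direction
  \<open>y\<close> in \<open>M\<close> would lead to a point of \<open>M\<close> closer to
  \<open>x\<close>.\<close>

lemma orthogonal_decomposition:
  fixes M :: "'a::{real_inner, complete_space} set"
  assumes M: "closed M" "subspace M"
  shows "\<exists>m\<in>M. \<forall>y\<in>M. inner (x - m) y = 0"
proof -
  obtain m where m: "m \<in> M" "\<And>y. y \<in> M \<Longrightarrow> norm (x - m) \<le> norm (x - y)"
    using nearest_point_exists[OF M] by blast
  have "inner (x - m) y = 0" if y: "y \<in> M" for y
  proof (cases "y = 0")
    case False
    \<comment> \<open>This \<open>t\<close> minimises the quadratic norm ((x - m) - t y)^2; the drop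
      it achieves, <x - m, y>^2 / <y, y>, cannot be positive.\<close>
    define t where "t = inner (x - m) y / inner y y"
    have "m + t *\<^sub>R y \<in> M" using M(2) m(1) y by (simp add: subspace_add subspace_scale)
    then have "(norm (x - m))\<^sup>2 \<le> (norm ((x - m) - t *\<^sub>R y))\<^sup>2"
      using m(2) by (simp add: diff_diff_eq)
    also have "\<dots> = (norm (x - m))\<^sup>2 - 2 * t * inner (x - m) y + t * t * inner y y"
      unfolding power2_norm_eq_inner inner_diff_left[of "x - m" "t *\<^sub>R y"]
        inner_diff_right[of _ "x - m" "t *\<^sub>R y"]
      by (simp add: inner_commute[of y "x - m"])
    also have "\<dots> = (norm (x - m))\<^sup>2 - (inner (x - m) y)\<^sup>2 / inner y y"
      using False by (simp add: t_def power2_eq_square)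
    finally have "(inner (x - m) y)\<^sup>2 / inner y y \<le> 0" by simp
    then show ?thesis
      using False by (simp add: divide_le_0_iff) (metis inner_gt_zero_iff not_less)
  qed simp
  then show ?thesis using m(1) by blast
qed

text \<open>The kernel of a nonzero \<open>f\<close> is a closed hyperplane. A vector
  \<open>n\<close> orthogonal to it and outside it determines \<open>f\<close>, because u - (f u / f
  n) n always lies in the kernel; scaling \<open>n\<close> gives the representing vector.\<close>

lemma riesz_representation:
  fixes f :: "'a::{real_inner, complete_space} \<Rightarrow> real"
  assumes f: "bounded_linear f"
  shows "\<exists>z. \<forall>x. f x = inner x z"
proof (cases "\<forall>x. f x = 0")
  case False
  interpret bounded_linear f by fact
  let ?N = "{x. f x = 0}"
  obtain x where x: "f x \<noteq> 0" using False by blast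
  have "closed ?N"
    by (intro closed_Collect_eq continuous_intros linear_continuous_on f)
  moreover have "subspace ?N" by (auto simp: subspace_def add scaleR zero)
  ultimately obtain m where m: "f m = 0" "\<And>y. f y = 0 \<Longrightarrow> inner (x - m) y = 0"
    using orthogonal_decomposition[of ?N x] by auto
  define n where "n = x - m"
  have fn: "f n \<noteq> 0" using x m(1) by (simp add: n_def diff)
  then have n0: "n \<noteq> 0" using zero by auto
  have "f u = inner u ((f n / inner n n) *\<^sub>R n)" for u
  proof -
    have "inner n (u - (f u / f n) *\<^sub>R n) = 0"
      unfolding n_def by (rule m(2)) (use fn in \<open>simp add: diff scaleR flip: n_def\<close>)
    then show ?thesis
      using fn n0 by (simp add: inner_diff_right inner_commute field_simps)
  qed
  then show ?thesis by blast
qed (auto intro: exI[of _ 0])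

section \<open>Complex inner product spaces\<close>

lemma cinner_add_right: "cinner x (y + z) = cinner x y + cinner x (z :: 'a::complex_inner)"
  by (metis cinner_add_left cinner_commute complex_cnj_add)

lemma cinner_scaleC_right: "cinner x (c *\<^sub>C y) = cnj c * cinner x (y :: 'a::complex_inner)"
  by (metis cinner_commute cinner_scaleC_left complex_cnj_mult)

lemma scaleC_minus_one: "(- 1) *\<^sub>C x = - (x :: 'a::complex_inner)"
  using scaleC_of_real[of "- 1" x] by simp

lemma cinner_minus_left: "cinner (- x) y = - cinner x (y :: 'a::complex_inner)"
  using cinner_scaleC_left[of "- 1" x y] by (simp add: scaleC_minus_one)

lemma cinner_minus_right: "cinner x (- y) = - cinner x (y :: 'a::complex_inner)"
  using cinner_scaleC_right[of x "- 1" y] by (simp add: scaleC_minus_one)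

lemma cinner_diff_left: "cinner (x - y) z = cinner x z - cinner y (z :: 'a::complex_inner)"
  using cinner_add_left[of x "- y" z] by (simp add: cinner_minus_left)

lemma cinner_diff_right: "cinner x (y - z) = cinner x y - cinner x (z :: 'a::complex_inner)"
  using cinner_add_right[of x y "- z"] by (simp add: cinner_minus_right)

lemma cinner_zero_left [simp]: "cinner 0 (x :: 'a::complex_inner) = 0"
  using cinner_diff_left[of 0 0 x] by simp

lemma cinner_zero_right [simp]: "cinner (x :: 'a::complex_inner) 0 = 0"
  using cinner_diff_right[of x 0 0] by simp

lemma cinner_eq_0_commute: "cinner x y = 0 \<longleftrightarrow> cinner y (x :: 'a::complex_inner) = 0"
  by (metis cinner_commute complex_cnj_zero)

text \<open>Conjugate linearity in the second argument turns the factor \<i> into -\<i>, and Re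
  (-\<i> w) = Im w. Complex statements thereby reduce to real inner products.\<close>

lemma Im_cinner: "Im (cinner x y) = inner x (\<i> *\<^sub>C (y :: 'a::complex_inner))"
  by (simp add: inner_eq_Re_cinner cinner_scaleC_right)

lemma cinner_eqI:
  fixes x y :: "'a::complex_inner"
  assumes "\<And>z. cinner z x = cinner z y"
  shows "x = y"
proof -
  have "cinner (x - y) (x - y) = 0" using assms by (simp add: cinner_diff_right)
  then show ?thesis by (simp add: cinner_self_eq_0_iff)
qed

text \<open>Expanding the form at x + y makes the two cross terms sum to zero; expanding it at x +
  \<i> y makes them equal. Membership is asked only of the four points used, so the form may vanish
  on a subspace alone.\<close>

lemma polarization_zero:
  fixes f :: "'a::complex_inner \<Rightarrow> 'a"
  assumes add: "\<And>x y. f (x + y) = f x + f y" and scale: "\<And>c x. f (c *\<^sub>C x) = c *\<^sub>C f x"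
    and zero: "\<And>x. x \<in> S \<Longrightarrow> cinner (f x) x = 0"
    and S: "x \<in> S" "y \<in> S" "x + y \<in> S" "x + \<i> *\<^sub>C y \<in> S"
  shows "cinner (f x) y = 0"
proof -
  have "cinner (f x) y + cinner (f y) x = 0"
    using zero[OF S(1)] zero[OF S(2)] zero[OF S(3)]
    by (simp add: add cinner_add_left cinner_add_right algebra_simps)
  \<comment> \<open>The cross terms of the form at x + \<i> y: \<i> leaves the second argument as
    -\<i> and the first as \<i>.\<close>
  moreover have "- (\<i> * cinner (f x) y) + \<i> * cinner (f y) x = 0"
    using zero[OF S(1)] zero[OF S(2)] zero[OF S(4)]
    by (simp add: add scale cinner_add_left cinner_add_right cinner_scaleC_left
        cinner_scaleC_right algebra_simps)
  then have "\<i> * (cinner (f y) x - cinner (f x) y) = 0" by (simp add: algebra_simps)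
  then have "cinner (f y) x = cinner (f x) y" by simp
  ultimately show ?thesis by simp
qed

section \<open>Orthogonal complements\<close>

text \<open>\<open>subspace\<close> concerns real scalars. Closure under multiplication by \<i> is
  what makes real orthogonality to the set imply complex orthogonality.\<close>

definition csubspace :: "'a::complex_inner set \<Rightarrow> bool" where
  "csubspace M \<longleftrightarrow> 0 \<in> M \<and> (\<forall>x\<in>M. \<forall>y\<in>M. x + y \<in> M) \<and> (\<forall>c. \<forall>x\<in>M. c *\<^sub>C x \<in> M)"

lemma csubspace_imp_subspace: "csubspace M \<Longrightarrow> subspace M"
  unfolding csubspace_def subspace_def by (metis scaleC_of_real)

lemma csubspace_diff: "csubspace M \<Longrightarrow> x \<in> M \<Longrightarrow> y \<in> M \<Longrightarrow> x - y \<in> M"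
  by (simp add: csubspace_imp_subspace subspace_diff)

lemma csubspace_ortho_compl: "csubspace (ortho_compl S)"
  by (simp add: csubspace_def ortho_compl_def cinner_add_left cinner_scaleC_left)

lemma ortho_compl_eq_inner:
  "ortho_compl S = {x. \<forall>y\<in>S. inner x y = 0 \<and> inner x (\<i> *\<^sub>C y) = 0}"
  by (auto simp: ortho_compl_def complex_eq_iff Im_cinner inner_eq_Re_cinner[symmetric])

lemma closed_ortho_compl: "closed (ortho_compl S)"
proof -
  have "ortho_compl S = (\<Inter>y\<in>S. {x. inner x y = 0} \<inter> {x. inner x (\<i> *\<^sub>C y) = 0})"
    by (auto simp: ortho_compl_eq_inner)
  moreover have "closed {x. inner x y = 0}" for y :: 'a
    by (intro closed_Collect_eq continuous_intros)
  ultimately show ?thesis by (simp add: closed_INT closed_Int)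
qed

text \<open>With \<open>y\<close> also \<i> y lies in \<open>M\<close>, so the imaginary parts are
  covered by the real condition. This carries the real decomposition over to the complex
  setting.\<close>

lemma ortho_compl_iff_real:
  assumes "csubspace M"
  shows "x \<in> ortho_compl M \<longleftrightarrow> (\<forall>y\<in>M. inner x y = 0)"
  using assms by (auto simp: ortho_compl_eq_inner csubspace_def)

lemma subset_double_ortho_compl: "S \<subseteq> ortho_compl (ortho_compl S)"
  by (auto simp: ortho_compl_def cinner_eq_0_commute)

lemma in_ortho_compl_self: "x \<in> S \<Longrightarrow> x \<in> ortho_compl S \<Longrightarrow> x = 0"
  by (auto simp: ortho_compl_def cinner_self_eq_0_iff)

lemma csubspace_closure:
  assumes M: "csubspace M"
  shows "csubspace (closure M)"
proof -
  have "x + y \<in> closure M" if xy: "x \<in> closure M" "y \<in> closure M" for x y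
  proof -
    obtain u v where "\<And>n. u n \<in> M" "u \<longlonglongrightarrow> x" "\<And>n. v n \<in> M" "v \<longlonglongrightarrow> y"
      using xy unfolding closure_sequential by blast
    then show ?thesis
      unfolding closure_sequential using M
      by (intro exI[of _ "\<lambda>n. u n + v n"]) (auto simp: csubspace_def intro: tendsto_add)
  qed
  moreover have "0 \<in> closure M"
    using M subsetD[OF closure_subset] by (auto simp: csubspace_def)
  moreover
  \<comment> \<open>Since norm (c x) = |c| norm x, scaling by \<open>c\<close> is continuous and
    therefore maps the closure of \<open>M\<close> into itself.\<close>
  have "bounded_linear (\<lambda>x::'a. c *\<^sub>C x)" for c
  proof (rule bounded_linear_intro[where K = "cmod c"])
    fix x y :: 'a and r :: real
    show "c *\<^sub>C (x + y) = c *\<^sub>C x + c *\<^sub>C y" by (rule scaleC_add_right)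
    show "c *\<^sub>C (r *\<^sub>R x) = r *\<^sub>R (c *\<^sub>C x)"
      by (simp add: scaleC_of_real[symmetric] scaleC_scaleC mult.commute)
    have "complex_of_real ((norm (c *\<^sub>C x))\<^sup>2) = (c * cnj c) * cinner x x"
      by (simp only: cinner_self[symmetric] cinner_scaleC_left cinner_scaleC_right mult_ac)
    also have "\<dots> = complex_of_real ((norm x * cmod c)\<^sup>2)"
      by (simp add: cinner_self complex_norm_square[symmetric] power_mult_distrib mult.commute)
    finally have "complex_of_real ((norm (c *\<^sub>C x))\<^sup>2) = complex_of_real ((norm x * cmod c)\<^sup>2)" .
    then have "(norm (c *\<^sub>C x))\<^sup>2 = (norm x * cmod c)\<^sup>2"
      using of_real_eq_iff by blast
    then show "norm (c *\<^sub>C x) \<le> norm x * cmod c"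
      by (simp add: power2_eq_iff_nonneg)
  qed
  then have "(\<lambda>x. c *\<^sub>C x) ` closure M \<subseteq> closure M" for c
  proof (intro image_closure_subset linear_continuous_on closed_closure)
    show "(\<lambda>x. c *\<^sub>C x) ` M \<subseteq> closure M"
      using M closure_subset[of M] by (auto simp: csubspace_def)
  qed
  ultimately show ?thesis
    unfolding csubspace_def by blast
qed

lemma complex_orthogonal_decomposition:
  fixes M :: "'a::chilbert_space set"
  assumes "closed M" "csubspace M"
  obtains m where "m \<in> M" "x - m \<in> ortho_compl M"
  using orthogonal_decomposition[of M x] assms
  by (auto simp: ortho_compl_iff_real csubspace_imp_subspace)

text \<open>Split \<open>x\<close> in the double complement as m + (x - m) with \<open>m\<close> in
  \<open>M\<close>. The remainder lies both in M^\<bottom> and in its complement, so it is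
  zero.\<close>

lemma double_ortho_compl_closed:
  fixes M :: "'a::chilbert_space set"
  assumes M: "closed M" "csubspace M"
  shows "ortho_compl (ortho_compl M) = M"
proof
  show "ortho_compl (ortho_compl M) \<subseteq> M"
  proof
    fix x assume x: "x \<in> ortho_compl (ortho_compl M)"
    obtain m where m: "m \<in> M" "x - m \<in> ortho_compl M"
      using complex_orthogonal_decomposition[OF M] .
    have "x - m \<in> ortho_compl (ortho_compl M)"
      using x m(1) subset_double_ortho_compl
      by (intro csubspace_diff csubspace_ortho_compl) auto
    then have "x - m = 0" using in_ortho_compl_self m(2) by blast
    then show "x \<in> M" using m(1) by simp
  qed
qed (rule subset_double_ortho_compl)

text \<open>The double complement of \<open>M\<close> is closed and contains \<open>M\<close>, hence
  contains its closure; so whatever is orthogonal to \<open>M\<close> is orthogonal to the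
  closure.\<close>

lemma ortho_compl_closure: "ortho_compl (closure M) = ortho_compl M"
proof
  show "ortho_compl (closure M) \<subseteq> ortho_compl M"
    using subsetD[OF closure_subset[of M]] by (auto simp: ortho_compl_def)
  have "closure M \<subseteq> ortho_compl (ortho_compl M)"
    by (intro closure_minimal subset_double_ortho_compl closed_ortho_compl)
  then show "ortho_compl M \<subseteq> ortho_compl (closure M)"
    by (force simp: ortho_compl_def cinner_eq_0_commute dest: subsetD)
qed

lemma double_ortho_compl:
  fixes M :: "'a::chilbert_space set"
  assumes "csubspace M"
  shows "ortho_compl (ortho_compl M) = closure M"
  using double_ortho_compl_closed[of "closure M"] assms
  by (simp add: csubspace_closure ortho_compl_closure)

section \<open>Adjoints\<close>

text \<open>Discharges the definite description: \<open>cinner_eqI\<close> forces any two maps with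
  the adjoint identity to agree. Used both to show that the adjoint exists and to compute
  it.\<close>

lemma cadjoint_eqI:
  assumes "\<And>x y. cinner (T x) y = cinner x (S y)"
  shows "cadjoint T = S"
  unfolding cadjoint_def
proof (rule the_equality)
  fix S' assume S': "\<forall>x y. cinner (T x) y = cinner x (S' y)"
  show "S' = S"
    by (rule ext, rule cinner_eqI) (simp flip: assms S'[rule_format])
qed (use assms in blast)

lemma bounded_clinearD:
  assumes "bounded_clinear T"
  shows bounded_clinear_bounded_linear: "bounded_linear T"
    and bounded_clinear_add: "T (x + y) = T x + T y"
    and bounded_clinear_diff: "T (x - y) = T x - T y"
    and bounded_clinear_zero: "T 0 = 0"
    and bounded_clinear_scaleC: "T (c *\<^sub>C x) = c *\<^sub>C T x"
proof -
  show T: "bounded_linear T" using assms by (simp add: bounded_clinear_def)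
  show "T (c *\<^sub>C x) = c *\<^sub>C T x" using assms by (simp add: bounded_clinear_def)
  show "T (x + y) = T x + T y" "T (x - y) = T x - T y" "T 0 = 0"
    by (fact linear_simps[OF T])+
qed

lemma cinner_cadjoint:
  fixes T :: "'a::chilbert_space \<Rightarrow> 'b::chilbert_space"
  assumes T: "bounded_clinear T"
  shows "cinner (T x) y = cinner x (cadjoint T y)"
proof -
  have "\<exists>z. \<forall>x. inner (T x) y = inner x z" for y
    by (intro riesz_representation bounded_linear_compose[OF bounded_linear_inner_left]
        bounded_clinear_bounded_linear T)
  then obtain S where S: "\<And>x y. inner (T x) y = inner x (S y)" by metis
  have "cinner (T x) y = cinner x (S y)" for x y
  proof (rule complex_eqI)
    show "Re (cinner (T x) y) = Re (cinner x (S y))"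
      using S by (simp add: inner_eq_Re_cinner[symmetric])
    \<comment> \<open>Riesz controls real parts only. Replacing \<open>x\<close> by -\<i> x turns
      the real part into the imaginary part of the original product.\<close>
    have "inner (T ((- \<i>) *\<^sub>C x)) y = inner ((- \<i>) *\<^sub>C x) (S y)" by (rule S)
    then show "Im (cinner (T x) y) = Im (cinner x (S y))"
      by (simp add: bounded_clinear_scaleC[OF T] inner_eq_Re_cinner cinner_scaleC_left)
  qed
  then show ?thesis using cadjoint_eqI[of T S] by simp
qed

lemma cinner_cadjoint':
  fixes T :: "'a::chilbert_space \<Rightarrow> 'b::chilbert_space"
  assumes T: "bounded_clinear T"
  shows "cinner (cadjoint T x) y = cinner x (T y)"
proof -
  have "cinner (cadjoint T x) y = cnj (cinner y (cadjoint T x))" by (rule cinner_commute)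
  also have "\<dots> = cnj (cinner (T y) x)" by (simp only: cinner_cadjoint[OF T])
  also have "\<dots> = cinner x (T y)" by (rule cinner_commute[symmetric])
  finally show ?thesis .
qed

lemma cadjoint_add:
  fixes T :: "'a::chilbert_space \<Rightarrow> 'b::chilbert_space"
  assumes T: "bounded_clinear T"
  shows "cadjoint T (x + y) = cadjoint T x + cadjoint T y"
  by (rule cinner_eqI) (simp add: cinner_cadjoint[OF T, symmetric] cinner_add_right)

lemma cadjoint_scaleC:
  fixes T :: "'a::chilbert_space \<Rightarrow> 'b::chilbert_space"
  assumes T: "bounded_clinear T"
  shows "cadjoint T (c *\<^sub>C x) = c *\<^sub>C cadjoint T x"
  by (rule cinner_eqI) (simp add: cinner_cadjoint[OF T, symmetric] cinner_scaleC_right)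

section \<open>Ranges, nullspaces and their orthogonal complements\<close>

text \<open>Asks for additivity and homogeneity only, so that it also applies to
  \<open>cadjoint T\<close>, whose boundedness is not established.\<close>

lemma csubspace_range:
  assumes "\<And>x y. f (x + y) = f x + f y" "\<And>c x. f (c *\<^sub>C x) = c *\<^sub>C f x"
  shows "csubspace (range f)"
proof -
  have "f 0 = 0" using assms(1)[of 0 0] by simp
  then have "0 \<in> range f" by (metis rangeI)
  then show ?thesis
    unfolding csubspace_def by (auto simp flip: assms)
qed

lemma csubspace_range_bounded_clinear: "bounded_clinear T \<Longrightarrow> csubspace (range T)"
  by (rule csubspace_range) (simp_all only: bounded_clinear_add bounded_clinear_scaleC)

lemma csubspace_range_cadjoint:
  fixes T :: "'a::chilbert_space \<Rightarrow> 'b::chilbert_space"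
  shows "bounded_clinear T \<Longrightarrow> csubspace (range (cadjoint T))"
  by (rule csubspace_range) (simp_all only: cadjoint_add cadjoint_scaleC)

lemma csubspace_nullspace:
  assumes T: "bounded_clinear T"
  shows "csubspace (nullspace T)"
proof -
  have "c *\<^sub>C 0 = (0::'b)" for c
    using scaleC_add_right[of c 0 "0::'b"] by simp
  then show ?thesis
    by (simp add: csubspace_def nullspace_def bounded_clinearD[OF T])
qed

lemma closed_nullspace: "bounded_clinear T \<Longrightarrow> closed (nullspace T)"
  unfolding nullspace_def
  by (intro closed_Collect_eq continuous_intros linear_continuous_on)
    (rule bounded_clinear_bounded_linear)

lemma closure_range:
  fixes T :: "'a::chilbert_space \<Rightarrow> 'b::chilbert_space"
  assumes T: "bounded_clinear T"
  shows "closure (range T) = ortho_compl (nullspace (cadjoint T))"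
proof -
  have "x \<in> ortho_compl (range T) \<longleftrightarrow> x \<in> nullspace (cadjoint T)" for x
  proof -
    have "x \<in> ortho_compl (range T) \<longleftrightarrow> (\<forall>z. cinner (cadjoint T x) z = 0)"
      by (simp add: ortho_compl_def cinner_cadjoint'[OF T])
    also have "\<dots> \<longleftrightarrow> cadjoint T x = 0"
      using cinner_self_eq_0_iff[of "cadjoint T x"] by auto
    finally show ?thesis by (simp add: nullspace_def)
  qed
  then have "ortho_compl (range T) = nullspace (cadjoint T)" by blast
  then show ?thesis
    using double_ortho_compl[OF csubspace_range_bounded_clinear[OF T]] by simp
qed

text \<open>The argument of \<open>closure_range\<close> with the roles of T and T* exchanged, run
  directly because that lemma would require T* to be bounded.\<close>

lemma closure_range_cadjoint:
  fixes T :: "'a::chilbert_space \<Rightarrow> 'b::chilbert_space"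
  assumes T: "bounded_clinear T"
  shows "closure (range (cadjoint T)) = ortho_compl (nullspace T)"
proof -
  have "x \<in> ortho_compl (range (cadjoint T)) \<longleftrightarrow> x \<in> nullspace T" for x
  proof -
    have "x \<in> ortho_compl (range (cadjoint T)) \<longleftrightarrow> (\<forall>z. cinner (T x) z = 0)"
      by (simp add: ortho_compl_def cinner_cadjoint[OF T])
    also have "\<dots> \<longleftrightarrow> T x = 0"
      using cinner_self_eq_0_iff[of "T x"] by auto
    finally show ?thesis by (simp add: nullspace_def)
  qed
  then have "ortho_compl (range (cadjoint T)) = nullspace T" by blast
  then show ?thesis
    using double_ortho_compl[OF csubspace_range_cadjoint[OF T]] by simp
qed

section \<open>Orthogonal projections\<close>

lemma
  assumes P: "orth_projection P"
  shows orth_projection_idem: "P (P x) = P x"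
    and orth_projection_symmetric: "cinner (P x) y = cinner x (P y)"
proof -
  have bP: "bounded_clinear P" using P by (simp add: orth_projection_def)
  show "P (P x) = P x" using P by (metis comp_apply orth_projection_def)
  show "cinner (P x) y = cinner x (P y)"
    using cinner_cadjoint[OF bP, of x y] P by (simp add: orth_projection_def)
qed

text \<open>Move the second \<open>P\<close> across by symmetry and apply idempotence. Thus x = P x
  + (x - P x) is the orthogonal decomposition along the range, which is why the range determines
  \<open>P\<close>.\<close>

lemma orth_projection_residual:
  assumes P: "orth_projection P"
  shows "x - P x \<in> ortho_compl (range P)"
proof -
  have "cinner (x - P x) (P y) = 0" for y
    using orth_projection_symmetric[OF P, of x "P y"]
    by (simp add: cinner_diff_left orth_projection_symmetric[OF P] orth_projection_idem[OF P])
  then show ?thesis by (auto simp: ortho_compl_def)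
qed

lemma decomposition_unique:
  assumes "csubspace M" "m \<in> M" "x - m \<in> ortho_compl M" "m' \<in> M" "x - m' \<in> ortho_compl M"
  shows "m = m'"
proof -
  have "(x - m') - (x - m) \<in> ortho_compl M"
    using csubspace_diff[OF csubspace_ortho_compl assms(5,3)] .
  then have "m - m' \<in> ortho_compl M" by simp
  moreover have "m - m' \<in> M" using assms by (intro csubspace_diff)
  ultimately show ?thesis using in_ortho_compl_self by fastforce
qed

lemma orth_projection_exists:
  fixes M :: "'a::chilbert_space set"
  assumes M: "closed M" "csubspace M"
  shows "\<exists>P. orth_projection P \<and> range P = M"
proof -
  have "\<exists>m\<in>M. x - m \<in> ortho_compl M" for x
    using complex_orthogonal_decomposition[OF M, of x] by blast
  then obtain P where P: "\<And>x. P x \<in> M" "\<And>x. x - P x \<in> ortho_compl M"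
    by metis
  \<comment> \<open>All algebraic properties of \<open>P\<close> are derived from this: a candidate
    value is correct once it lies in \<open>M\<close> and leaves a remainder in M^\<bottom>.\<close>
  have uniq: "P x = m" if "m \<in> M" "x - m \<in> ortho_compl M" for x m
    using decomposition_unique[OF M(2)] P that by metis
  have closedM: "x + y \<in> M" "c *\<^sub>C x \<in> M" if "x \<in> M" "y \<in> M" for x y c
    using M(2) that by (auto simp: csubspace_def)
  have closedO: "x + y \<in> ortho_compl M" "c *\<^sub>C x \<in> ortho_compl M"
    if "x \<in> ortho_compl M" "y \<in> ortho_compl M" for x y c
    using csubspace_ortho_compl[of M] that by (auto simp: csubspace_def)
  have add: "P (x + y) = P x + P y" for x y
    using closedO(1)[OF P(2)[of x] P(2)[of y]] P(1)
    by (intro uniq closedM) (auto simp: algebra_simps)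
  have scale: "P (c *\<^sub>C x) = c *\<^sub>C P x" for c x
  proof (rule uniq)
    have "c *\<^sub>C (x - P x) + c *\<^sub>C P x = c *\<^sub>C x" by (simp flip: scaleC_add_right)
    then show "c *\<^sub>C x - c *\<^sub>C P x \<in> ortho_compl M"
      using closedO(2)[OF P(2)[of x] P(2)[of x], of c] by (metis add_diff_cancel_right')
  qed (use closedM P(1) in blast)
  have fixed: "P m = m" if "m \<in> M" for m
    using that by (intro uniq) (auto simp: ortho_compl_def)
  \<comment> \<open>Pythagoras makes \<open>P\<close> a contraction, hence bounded with constant
    1.\<close>
  have "norm (P x) \<le> norm x * 1" for x
  proof -
    have "inner (x - P x) (P x) = 0"
      using P ortho_compl_iff_real[OF M(2)] by blast
    then have "(norm x)\<^sup>2 = (norm (P x))\<^sup>2 + (norm (x - P x))\<^sup>2"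
      by (simp add: power2_norm_eq_inner inner_diff_left inner_diff_right inner_commute)
    then show ?thesis using power2_le_imp_le[of "norm (P x)" "norm x"] by simp
  qed
  then have "bounded_linear P"
    by (intro bounded_linear_intro[where K = 1])
      (use add scale scaleC_of_real in \<open>auto simp flip: scaleC_of_real\<close>)
  then have "bounded_clinear P" using scale by (simp add: bounded_clinear_def)
  moreover have "P \<circ> P = P" using P(1) fixed by auto
  moreover have "cadjoint P = P"
  proof (rule cadjoint_eqI)
    fix x y
    have "cinner (x - P x) (P y) = 0" "cinner (y - P y) (P x) = 0"
      using P by (auto simp: ortho_compl_def)
    moreover from this(2) have "cinner (P x) (y - P y) = 0"
      by (rule cinner_eq_0_commute[THEN iffD1])
    ultimately show "cinner (P x) y = cinner x (P y)"
      by (simp add: cinner_diff_left cinner_diff_right)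
  qed
  moreover have "range P = M"
    using P(1) fixed by (metis image_subset_iff rangeI subsetI subset_antisym)
  ultimately show ?thesis by (auto simp: orth_projection_def)
qed

lemma orth_proj_onto:
  fixes M :: "'a::chilbert_space set"
  assumes M: "closed M" "csubspace M"
  shows orth_projection_orth_proj_onto: "orth_projection (orth_proj_onto M)"
    and range_orth_proj_onto: "range (orth_proj_onto M) = M"
proof -
  have "\<exists>!P. orth_projection P \<and> range P = M"
  proof (rule ex_ex1I[OF orth_projection_exists[OF M]])
    fix P Q assume PQ: "orth_projection P \<and> range P = M" "orth_projection Q \<and> range Q = M"
    show "P = Q"
    proof
      fix x
      show "P x = Q x"
        using PQ orth_projection_residual[of P x] orth_projection_residual[of Q x]
        by (intro decomposition_unique[OF M(2), of "P x" x]) auto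
    qed
  qed
  from theI'[OF this] show "orth_projection (orth_proj_onto M)" "range (orth_proj_onto M) = M"
    by (auto simp: orth_proj_onto_def)
qed

lemma orth_proj_onto_eqI:
  fixes M :: "'a::chilbert_space set"
  assumes "closed M" "csubspace M" "m \<in> M" "x - m \<in> ortho_compl M"
  shows "orth_proj_onto M x = m"
proof (rule decomposition_unique[OF assms(2)])
  show "orth_proj_onto M x \<in> M" using range_orth_proj_onto[OF assms(1,2)] by blast
  show "x - orth_proj_onto M x \<in> ortho_compl M"
    using orth_projection_residual[OF orth_projection_orth_proj_onto[OF assms(1,2)]]
      range_orth_proj_onto[OF assms(1,2)] by metis
qed (use assms in auto)

lemma orth_proj_onto_residual:
  fixes M :: "'a::chilbert_space set"
  assumes "closed M" "csubspace M"
  shows "x - orth_proj_onto M x \<in> ortho_compl M"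
  by (metis assms complex_orthogonal_decomposition orth_proj_onto_eqI)

section \<open>Products of two projections\<close>

text \<open>The part removed by the projection lies in the double complement of N(T), which is N(T)
  itself because N(T) is closed. Questions about T x thus reduce to vectors in
  N(T)^\<bottom>.\<close>

lemma apply_proj_ortho_nullspace:
  fixes T :: "'a::chilbert_space \<Rightarrow> 'b::chilbert_space"
  assumes T: "bounded_clinear T"
  shows "T (orth_proj_onto (ortho_compl (nullspace T)) x) = T x"
proof -
  have "x - orth_proj_onto (ortho_compl (nullspace T)) x \<in> ortho_compl (ortho_compl (nullspace T))"
    by (intro orth_proj_onto_residual closed_ortho_compl csubspace_ortho_compl)
  then have "T (x - orth_proj_onto (ortho_compl (nullspace T)) x) = 0"
    by (simp add: double_ortho_compl_closed closed_nullspace csubspace_nullspace T)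
      (simp add: nullspace_def)
  then show ?thesis by (simp add: bounded_clinear_diff[OF T])
qed

section \<open>The equivalent conditions and the canonical factorisation\<close>

text \<open>The adjoint of PQ is QP, so T T* T = PQQPPQ collapses to PQPQ = T^2.\<close>

lemma square_identity_of_projections:
  assumes P: "orth_projection P" and Q: "orth_projection Q" and T: "T = P \<circ> Q"
  shows "T \<circ> T = T \<circ> cadjoint T \<circ> T"
proof -
  have "cadjoint T = Q \<circ> P"
    by (rule cadjoint_eqI) (simp add: T orth_projection_symmetric[OF P] orth_projection_symmetric[OF Q])
  then show ?thesis
    by (simp add: T fun_eq_iff orth_projection_idem[OF P] orth_projection_idem[OF Q])
qed

lemma square_identity_imp_cinner:
  fixes T :: "'a::chilbert_space \<Rightarrow> 'a"
  assumes T: "bounded_clinear T" and sq: "T \<circ> T = T \<circ> cadjoint T \<circ> T"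
    and z: "z \<in> ortho_compl (nullspace T)"
  shows "cinner (T x) z = cinner (T x) (T z)"
proof -
  have "T (T x) = T (cadjoint T (T x))" using fun_cong[OF sq, of x] by simp
  then have "T x - cadjoint T (T x) \<in> nullspace T"
    by (simp add: nullspace_def bounded_clinear_diff[OF T])
  then have "cinner (T x - cadjoint T (T x)) z = 0"
    using z by (subst cinner_eq_0_commute) (simp add: ortho_compl_def)
  then show ?thesis by (simp add: cinner_diff_left cinner_cadjoint'[OF T])
qed

text \<open>On K = N(T)^\<bottom> the hypothesis says that the form of f = T - T*T vanishes.
  Polarised, it puts f k in K^\<bottom> = N(T) for k in K, that is T (T k) = T (T* (T k)); a general
  \<open>x\<close> has the same image under T as its projection \<open>k\<close> to K.\<close>

lemma norm_identity_imp_square_identity: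
  fixes T :: "'a::chilbert_space \<Rightarrow> 'a"
  assumes T: "bounded_clinear T"
    and norm_eq: "\<And>x. x \<in> ortho_compl (nullspace T) \<Longrightarrow>
      complex_of_real ((norm (T x))\<^sup>2) = cinner (T x) x"
  shows "T \<circ> T = T \<circ> cadjoint T \<circ> T"
proof
  fix x
  let ?K = "ortho_compl (nullspace T)"
  define k where "k = orth_proj_onto ?K x"
  \<comment> \<open>The difference is written as a sum with factor -1, so that the rules for
    \<open>scaleC\<close> and \<open>cinner\<close> on sums apply.\<close>
  define f where "f u = T u + (- 1) *\<^sub>C cadjoint T (T u)" for u
  have kK: "k \<in> ?K"
    unfolding k_def by (metis closed_ortho_compl csubspace_ortho_compl range_orth_proj_onto rangeI)
  have Tk: "T k = T x" unfolding k_def by (rule apply_proj_ortho_nullspace[OF T])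
  have "cinner (f k) y = 0" if y: "y \<in> ?K" for y
  proof (rule polarization_zero[where f = f and S = ?K])
    show "f (u + v) = f u + f v" for u v
      by (simp add: f_def bounded_clinear_add[OF T] cadjoint_add[OF T] scaleC_add_right)
    show "f (c *\<^sub>C u) = c *\<^sub>C f u" for c u
      by (simp add: f_def bounded_clinear_scaleC[OF T] cadjoint_scaleC[OF T] scaleC_add_right
          scaleC_scaleC)
    show "cinner (f u) u = 0" if "u \<in> ?K" for u
      using norm_eq[OF that]
      by (simp add: f_def cinner_add_left cinner_scaleC_left cinner_cadjoint'[OF T] cinner_self)
  qed (use kK y csubspace_ortho_compl[of "nullspace T"] in \<open>auto simp: csubspace_def\<close>)
  then have "f k \<in> ortho_compl ?K" by (simp add: ortho_compl_def[of ?K])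
  then have "T (T k - cadjoint T (T k)) = 0"
    by (simp add: double_ortho_compl_closed closed_nullspace csubspace_nullspace T f_def
        scaleC_minus_one) (simp add: nullspace_def)
  then show "(T \<circ> T) x = (T \<circ> cadjoint T \<circ> T) x"
    by (simp add: bounded_clinear_diff[OF T] Tk)
qed

lemma square_identity_imp_factorization:
  fixes T :: "'a::chilbert_space \<Rightarrow> 'a"
  assumes T: "bounded_clinear T" and sq: "T \<circ> T = T \<circ> cadjoint T \<circ> T"
  shows "T = orth_proj_onto (closure (range T)) \<circ> orth_proj_onto (ortho_compl (nullspace T))"
proof
  fix x
  let ?K = "ortho_compl (nullspace T)"
  define k where "k = orth_proj_onto ?K x"
  have kK: "k \<in> ?K"
    unfolding k_def by (metis closed_ortho_compl csubspace_ortho_compl range_orth_proj_onto rangeI)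
  have Tk: "T k = T x" unfolding k_def by (rule apply_proj_ortho_nullspace[OF T])
  have "orth_proj_onto (closure (range T)) k = T k"
  proof (rule orth_proj_onto_eqI)
    have "cinner (T z) (k - T k) = 0" for z
      using square_identity_imp_cinner[OF T sq kK] by (simp add: cinner_diff_right)
    then show "k - T k \<in> ortho_compl (closure (range T))"
      unfolding ortho_compl_closure by (auto simp: ortho_compl_def cinner_eq_0_commute)
    show "T k \<in> closure (range T)" by (rule subsetD[OF closure_subset rangeI])
    show "csubspace (closure (range T))"
      by (intro csubspace_closure csubspace_range_bounded_clinear T)
  qed simp
  then show "T x = (orth_proj_onto (closure (range T)) \<circ> orth_proj_onto ?K) x"
    by (simp add: Tk flip: k_def)
qed

theorem theorem3p1:
  fixes T :: "'a::chilbert_space \<Rightarrow> 'a"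
  assumes "bounded_clinear T"
  shows "(T \<in> proj_products \<longleftrightarrow> T \<circ> T = T \<circ> cadjoint T \<circ> T)
    \<and> (T \<circ> T = T \<circ> cadjoint T \<circ> T \<longleftrightarrow>
         (\<forall>x \<in> ortho_compl (nullspace T). complex_of_real ((norm (T x))\<^sup>2) = cinner (T x) x))
    \<and> (T \<in> proj_products \<longrightarrow>
         T = orth_proj_onto (closure (range T)) \<circ> orth_proj_onto (ortho_compl (nullspace T))
       \<and> T = orth_proj_onto (closure (range T)) \<circ> orth_proj_onto (closure (range (cadjoint T)))
       \<and> T = orth_proj_onto (ortho_compl (nullspace (cadjoint T)))
             \<circ> orth_proj_onto (ortho_compl (nullspace T)))"
proof -
  let ?P = "orth_proj_onto (closure (range T))"
  let ?Q = "orth_proj_onto (ortho_compl (nullspace T))"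
  let ?sq = "T \<circ> T = T \<circ> cadjoint T \<circ> T"
  have "?sq" if "T \<in> proj_products"
    using that square_identity_of_projections by (auto simp: proj_products_def)
  moreover have factor: "T = ?P \<circ> ?Q" if ?sq
    using square_identity_imp_factorization[OF assms that] .
  moreover have "T \<in> proj_products" if ?sq
  proof -
    have "orth_projection ?P"
      by (intro orth_projection_orth_proj_onto closed_closure csubspace_closure
          csubspace_range_bounded_clinear assms)
    moreover have "orth_projection ?Q"
      by (intro orth_projection_orth_proj_onto closed_ortho_compl csubspace_ortho_compl)
    ultimately show ?thesis using factor[OF that] by (auto simp: proj_products_def)
  qed
  moreover have "complex_of_real ((norm (T x))\<^sup>2) = cinner (T x) x"
    if ?sq "x \<in> ortho_compl (nullspace T)" for x
    using square_identity_imp_cinner[OF assms that] by (simp add: cinner_self)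
  moreover note norm_identity_imp_square_identity[OF assms]
  \<comment> \<open>The two range identities rewrite the second and third factorisations into the
    first, so \<open>factor\<close> settles all three.\<close>
  ultimately show ?thesis
    unfolding closure_range_cadjoint[OF assms] closure_range[OF assms, symmetric] by blast
qed

end
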